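(* Let $2\le q<p$ be constants. There is a (sufficiently small) constant $c>0$ such that the following holds: if a randomized algorithm solves the $\ell_p$ regression problem up to a relative error of $c\,d^{\frac12\left(1-\frac qp\right)}$, i.e., given any $A\in\mathbb R^{n\times d}$ and query access to any $b\in\mathbb R^n$ it outputs $\tilde x$ with $$\|A\tilde x-b\|_p\le c\,d^{\frac12\left(1-\frac qp\right)}\min_{x\in\mathbb R^d}\|Ax-b\|_p$$ with probability at least $0.99$, and it queries $m$ entries of $b$ in expectation, then $m=\Omega(d^{q/2})$.
   Context: Active regression: the design matrix $A$ is fully known to the algorithm, while each entry of $b$ read counts as one query. The lower bound is worst case over instances with $d$ columns ($n$ may depend on $d$, $p$, $q$); $m$ is the worst-case expected number of queries. The constant in $\Omega(\cdot)$ may depend on $p$ and $q$. *)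

theory Defs
  imports "HOL-Probability.Probability" "Jordan_Normal_Form.Matrix"
begin

no_notation vec_nth (infixl "$" 90)
hide_const (open) Finite_Cartesian_Product.vec
hide_type (open) Finite_Cartesian_Product.vec

definition lp_norm :: "real \<Rightarrow> real vec \<Rightarrow> real" where
  "lp_norm p v = (\<Sum>i<dim_vec v. \<bar>v $ i\<bar> powr p) powr (1 / p)"

text \<open>
  A deterministic adaptive algorithm for a fixed design matrix: \<open>Query i f\<close> reads entry \<open>i\<close> of
  the hidden vector \<open>b\<close> and continues with \<open>f (b $ i)\<close>. Computation between queries is
  unrestricted, so the continuation is an arbitrary function of the value read.
\<close>

datatype decision_tree =
  Output "real vec"
| Query nat "real \<Rightarrow> decision_tree"

primrec answer :: "real vec \<Rightarrow> decision_tree \<Rightarrow> real vec" where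
  "answer b (Output x) = x"
| "answer b (Query i f) = answer b (f (b $ i))"

primrec queried :: "real vec \<Rightarrow> decision_tree \<Rightarrow> nat set" where
  "queried b (Output x) = {}"
| "queried b (Query i f) = insert i (queried b (f (b $ i)))"

primrec well_formed :: "nat \<Rightarrow> nat \<Rightarrow> decision_tree \<Rightarrow> bool" where
  "well_formed n d (Output x) \<longleftrightarrow> x \<in> carrier_vec d"
| "well_formed n d (Query i f) \<longleftrightarrow> i < n \<and> (\<forall>r. well_formed n d (f r))"

text \<open>
  A randomized algorithm is a probability distribution over deterministic ones. The
  sigma-algebra on decision trees is left arbitrary, so that every source of randomness is
  covered: a random tree on any probability space induces such a distribution, on the
  sigma-algebra of all sets of trees with measurable preimage.
\<close>

definition randomized_algorithm :: "nat \<Rightarrow> nat \<Rightarrow> decision_tree measure \<Rightarrow> bool" where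
  "randomized_algorithm n d M \<longleftrightarrow>
     prob_space M \<and>
     (\<forall>T\<in>space M. well_formed n d T) \<and>
     (\<forall>b\<in>carrier_vec n. (\<lambda>T. card (queried b T)) \<in> measurable M (count_space UNIV))"

text \<open>
  The infimum over \<open>x\<close> below is the minimum in the informal statement (it is attained, being the
  distance of \<open>b\<close> to a finite-dimensional subspace).
\<close>

definition approx_solution :: "real \<Rightarrow> real \<Rightarrow> real mat \<Rightarrow> real vec \<Rightarrow> real vec \<Rightarrow> bool" where
  "approx_solution p \<kappa> A b y \<longleftrightarrow>
     lp_norm p (A *\<^sub>v y - b) \<le> \<kappa> * (INF x\<in>carrier_vec (dim_col A). lp_norm p (A *\<^sub>v x - b))"

text \<open>
  The algorithm may depend arbitrarily on \<open>A\<close>, but on \<open>b\<close> only through its queries. Sets outside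
  the sigma-algebra have \<open>measure\<close> 0, so the bound on the success probability also asserts that
  success is an event.
\<close>

definition solves_lp_regression ::
  "real \<Rightarrow> real \<Rightarrow> nat \<Rightarrow> nat \<Rightarrow> (real mat \<Rightarrow> decision_tree measure) \<Rightarrow> bool" where
  "solves_lp_regression p \<kappa> n d alg \<longleftrightarrow>
     (\<forall>A\<in>carrier_mat n d.
        randomized_algorithm n d (alg A) \<and>
        (\<forall>b\<in>carrier_vec n.
           measure (alg A) {T \<in> space (alg A). approx_solution p \<kappa> A b (answer b T)} \<ge> 0.99))"

definition expected_queries :: "decision_tree measure \<Rightarrow> real vec \<Rightarrow> ennreal" where
  "expected_queries M b = (\<integral>\<^sup>+ T. of_nat (card (queried b T)) \<partial>M)"

definition worst_case_queries ::
  "nat \<Rightarrow> nat \<Rightarrow> (real mat \<Rightarrow> decision_tree measure) \<Rightarrow> ennreal" where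
  "worst_case_queries n d alg =
     (SUP A\<in>carrier_mat n d. SUP b\<in>carrier_vec n. expected_queries (alg A) b)"

end

theory Submission imports Defs begin

text \<open>
  The rows of the hard design matrix are \<open>n \<approx> d\<^sup>q\<^sup>/\<^sup>2\<close> sign vectors \<open>a\<^sub>i\<close> in \<open>{1, -1}\<^sup>d\<close> whose inner products
  are of the random order \<open>\<surd>d\<close> in \<open>p\<close>-th mean. For at least half of the \<open>i\<close>, the solution
  \<open>x = a\<^sub>i / d\<close> then fits the unit vector \<open>e\<^sub>i\<close> up to an error of order
  \<open>n powr (1/p) / \<surd>d = d powr (-(1 - q/p)/2)\<close>, so a successful algorithm has an error less than
  \<open>1\<close> on \<open>b = e\<^sub>i\<close>. On \<open>b = 0\<close> it must return an exact solution, whose error on \<open>e\<^sub>i\<close> is \<open>1\<close>;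
  so a decision tree that succeeds on both has to read entry \<open>i\<close> when run on \<open>b = 0\<close>. This happens
  with probability at least \<open>0.98\<close> for each such \<open>i\<close>. Only the success events, not the events that
  entry \<open>i\<close> is read, are known to be measurable, so the number of queries is bounded below by
  the sum of the indicators of the former.
\<close>

section \<open>Moments of the inner product with a uniformly random sign vector\<close>

lemma sum_exp_sign_inner:
  fixes a :: "nat \<Rightarrow> real"
  assumes "\<And>k. k < d \<Longrightarrow> a k \<in> {1, -1}"
  shows "(\<Sum>s\<in>PiE {..<d} (\<lambda>_. {1, -1}). exp (t * (\<Sum>k<d. s k * a k))) = (exp t + exp (- t)) ^ d"
proof -
  have "(\<Sum>s\<in>PiE {..<d} (\<lambda>_. {1, -1}). exp (t * (\<Sum>k<d. s k * a k)))
      = (\<Sum>s\<in>PiE {..<d} (\<lambda>_. {1, -1}). \<Prod>k<d. exp (t * (s k * a k)))"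
    by (simp add: sum_distrib_left exp_sum)
  also have "\<dots> = (\<Prod>k<d. \<Sum>r\<in>{1, -1::real}. exp (t * (r * a k)))"
    by (rule prod_sum_PiE [symmetric]) auto
  \<comment> \<open>Whichever sign \<open>a k\<close> has, letting \<open>r\<close> run over both
    signs produces \<open>exp t\<close> and \<open>exp (- t)\<close> once each.\<close>
  also have "\<dots> = (\<Prod>k<d. exp t + exp (- t))"
    using assms by (intro prod.cong) (fastforce simp: add.commute)+
  finally show ?thesis by simp
qed

text \<open>The linear terms of the two quadratic upper bounds cancel. Only a term in
  \<open>t\<^sup>2\<close> remains, so for \<open>t = 1 / sqrt d\<close> the \<open>d\<close>-th
  power is \<open>2 ^ d\<close> up to a constant factor.\<close>

lemma exp_add_exp_minus_le:
  fixes t :: real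
  assumes "0 \<le> t" "t \<le> 1"
  shows "exp t + exp (- t) \<le> 2 * (1 + t\<^sup>2)"
proof -
  have "exp (- t) \<le> 1 / (1 + t)"
    using exp_ge_add_one_self[of t] assms by (simp add: exp_minus divide_simps)
  also have "\<dots> \<le> 1 - t + t\<^sup>2"
  proof -
    have "(1 - t + t\<^sup>2) * (1 + t) = 1 + t ^ 3"
      by (simp add: algebra_simps power2_eq_square power3_eq_cube)
    then show ?thesis using assms by (simp add: divide_le_eq)
  qed
  finally show ?thesis using exp_bound[OF assms] by simp
qed

definition powr_exp_const :: "real \<Rightarrow> real" where
  "powr_exp_const p = 1 + fact (nat \<lceil>p\<rceil>)"

lemma powr_exp_const_pos: "powr_exp_const p > 0"
  by (simp add: powr_exp_const_def add_pos_pos)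

text \<open>For \<open>\<bar>y\<bar> > 1\<close> the exponent is rounded up to an integer
  \<open>N\<close>, and a single term of the exponential series gives
  \<open>\<bar>y\<bar> ^ N \<le> fact N * exp \<bar>y\<bar>\<close>. The summand 1 of the constant
  covers \<open>\<bar>y\<bar> \<le> 1\<close>.\<close>

lemma abs_powr_le_exp:
  fixes y p :: real
  assumes "0 \<le> p"
  shows "\<bar>y\<bar> powr p \<le> powr_exp_const p * (exp y + exp (- y))"
proof -
  define N where "N = nat \<lceil>p\<rceil>"
  have "\<bar>y\<bar> ^ N / fact N \<le> (\<Sum>k. \<bar>y\<bar> ^ k /\<^sub>R fact k)"
  proof -
    have "sum (\<lambda>k. \<bar>y\<bar> ^ k /\<^sub>R fact k) {N} \<le> (\<Sum>k. \<bar>y\<bar> ^ k /\<^sub>R fact k)"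
      by (rule sum_le_suminf[OF summable_exp_generic]) auto
    then show ?thesis by (simp add: field_simps)
  qed
  then have *: "\<bar>y\<bar> ^ N \<le> fact N * exp \<bar>y\<bar>"
    by (simp add: exp_def divide_le_eq mult.commute)
  have "\<bar>y\<bar> powr p \<le> 1 + \<bar>y\<bar> ^ N"
  proof (cases "\<bar>y\<bar> \<le> 1")
    case True
    then have "\<bar>y\<bar> powr p \<le> 1" using assms by (simp add: powr_le1)
    then show ?thesis by (smt (verit) zero_le_power abs_ge_zero)
  next
    case False
    then have "\<bar>y\<bar> powr p \<le> \<bar>y\<bar> powr real N"
      by (intro powr_mono) (auto simp: N_def of_nat_ceiling)
    then show ?thesis using False by (simp add: powr_realpow)
  qed
  also have "\<dots> \<le> (1 + fact N) * exp \<bar>y\<bar>"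
    using * by (simp add: algebra_simps add_mono)
  also have "\<dots> \<le> (1 + fact N) * (exp y + exp (- y))"
    by (intro mult_left_mono) (auto simp: abs_if)
  finally show ?thesis by (simp add: powr_exp_const_def N_def)
qed

text \<open>After division by the number \<open>2 ^ d\<close> of sign vectors this is a moment bound
  independent of \<open>d\<close>. The exponential moment at \<open>t = 1 / sqrt d\<close> is at
  most \<open>(1 + 1/d) ^ d\<close>, hence at most \<open>exp 1\<close>; the factor 2 accounts for
  the parameters \<open>t\<close> and \<open>- t\<close>.\<close>

lemma sum_sign_inner_powr_le:
  fixes a :: "nat \<Rightarrow> real"
  assumes a: "\<And>k. k < d \<Longrightarrow> a k \<in> {1, -1}" and "d \<ge> 1" "0 \<le> p"
  shows "(\<Sum>s\<in>PiE {..<d} (\<lambda>_. {1, -1}). \<bar>(\<Sum>k<d. s k * a k) / sqrt d\<bar> powr p)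
           \<le> powr_exp_const p * (2 * exp 1) * 2 ^ d"
proof -
  define t where "t = 1 / sqrt (real d)"
  have t: "0 \<le> t" "t \<le> 1" "t\<^sup>2 = 1 / d"
    using \<open>d \<ge> 1\<close> by (auto simp: t_def power_divide)
  have "(exp t + exp (- t)) ^ d \<le> (2 * (1 + 1 / real d)) ^ d"
    using exp_add_exp_minus_le[OF t(1,2)] t(3) by (intro power_mono add_nonneg_nonneg) auto
  also have "\<dots> = 2 ^ d * (1 + 1 / real d) ^ d" by (rule power_mult_distrib)
  also have "\<dots> \<le> 2 ^ d * exp (1 / real d) ^ d"
    by (intro mult_left_mono power_mono) (auto simp: exp_ge_add_one_self)
  also have "exp (1 / real d) ^ d = exp 1"
    using \<open>d \<ge> 1\<close> by (simp flip: exp_of_nat_mult)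
  finally have *: "(exp t + exp (- t)) ^ d \<le> 2 ^ d * exp 1" .
  have "(\<Sum>s\<in>PiE {..<d} (\<lambda>_. {1, -1}). \<bar>(\<Sum>k<d. s k * a k) / sqrt d\<bar> powr p)
      \<le> (\<Sum>s\<in>PiE {..<d} (\<lambda>_. {1, -1}). powr_exp_const p *
           (exp (t * (\<Sum>k<d. s k * a k)) + exp (- t * (\<Sum>k<d. s k * a k))))"
  proof (rule sum_mono)
    fix s
    show "\<bar>(\<Sum>k<d. s k * a k) / sqrt d\<bar> powr p \<le> powr_exp_const p *
           (exp (t * (\<Sum>k<d. s k * a k)) + exp (- t * (\<Sum>k<d. s k * a k)))"
      using abs_powr_le_exp[OF \<open>0 \<le> p\<close>, of "(\<Sum>k<d. s k * a k) / sqrt d"] by (simp add: t_def)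
  qed
  also have "\<dots> = powr_exp_const p * (2 * (exp t + exp (- t)) ^ d)"
    using sum_exp_sign_inner[of d a t, OF a] sum_exp_sign_inner[of d a "- t", OF a]
    by (simp add: sum.distrib add.commute flip: sum_distrib_left)
  also have "\<dots> \<le> powr_exp_const p * (2 * (2 ^ d * exp 1))"
    using * powr_exp_const_pos[of p] by (intro mult_left_mono) auto
  finally show ?thesis by (simp add: mult_ac)
qed

section \<open>Sign vectors that are nearly orthogonal in \<open>p\<close>-th mean\<close>

definition inner_powr :: "real \<Rightarrow> nat \<Rightarrow> (nat \<Rightarrow> nat \<Rightarrow> real) \<Rightarrow> nat \<Rightarrow> nat \<Rightarrow> real" where
  "inner_powr p d s i j = (if i = j then 0 else \<bar>(\<Sum>k<d. s i k * s j k) / sqrt d\<bar> powr p)"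

lemma inner_powr_commute: "inner_powr p d s i j = inner_powr p d s j i"
  by (auto simp: inner_powr_def mult.commute)

lemma inner_powr_nonneg: "0 \<le> inner_powr p d s i j"
  by (simp add: inner_powr_def)

text \<open>
  Greedy choice: the next vector is at most average, over all sign vectors, in its sum against the
  vectors already chosen.
\<close>

lemma exists_sign_vectors:
  assumes "d \<ge> 1" "0 \<le> p"
  shows "\<exists>s. (\<forall>i<n. \<forall>k<d. s i k \<in> {1, -1}) \<and>
           (\<Sum>i<n. \<Sum>j<n. inner_powr p d s i j) \<le> powr_exp_const p * (2 * exp 1) * (real n)\<^sup>2"
proof (induction n)
  case 0
  then show ?case by simp
next
  case (Suc n)
  define B where "B = powr_exp_const p * (2 * exp 1)"
  have B: "B > 0" using powr_exp_const_pos by (simp add: B_def)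
  obtain s where s: "\<And>i k. i < n \<Longrightarrow> k < d \<Longrightarrow> s i k \<in> {1, -1}"
    and sum: "(\<Sum>i<n. \<Sum>j<n. inner_powr p d s i j) \<le> B * (real n)\<^sup>2"
    using Suc unfolding B_def by blast
  define V where "V = PiE {..<d} (\<lambda>_. {1, -1 :: real})"
  define F where "F v = (\<Sum>j<n. \<bar>(\<Sum>k<d. v k * s j k) / sqrt d\<bar> powr p)" for v
  have V: "finite V" "card V = 2 ^ d" "V \<noteq> {}"
    by (auto simp: V_def card_PiE finite_PiE PiE_eq_empty_iff numeral_2_eq_2)
  have "sum F V = (\<Sum>j<n. \<Sum>v\<in>V. \<bar>(\<Sum>k<d. v k * s j k) / sqrt d\<bar> powr p)"
    unfolding F_def by (rule sum.swap)
  also have "\<dots> \<le> (\<Sum>j<n. B * 2 ^ d)"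
    unfolding V_def B_def using s assms by (intro sum_mono sum_sign_inner_powr_le) auto
  finally have le: "sum F V \<le> (\<Sum>v\<in>V. B * n)" using V by (simp add: mult_ac)
  obtain v where v: "v \<in> V" "F v \<le> B * n"
  proof -
    have "\<exists>v\<in>V. F v \<le> B * n"
    proof (rule ccontr)
      assume "\<not> ?thesis"
      then have "(\<Sum>v\<in>V. B * n) < sum F V"
        using V by (intro sum_strict_mono) auto
      with le show False by simp
    qed
    then show ?thesis using that by blast
  qed
  define s' where "s' = s(n := v)"
  have eq: "inner_powr p d s' i j = inner_powr p d s i j" if "i < n" "j < n" for i j
    using that by (auto simp: s'_def inner_powr_def)
  have F: "(\<Sum>j<n. inner_powr p d s' n j) = F v"
    unfolding F_def by (intro sum.cong) (auto simp: s'_def inner_powr_def)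
  then have F': "(\<Sum>j<n. inner_powr p d s' j n) = F v"
    by (simp add: inner_powr_commute)
  \<comment> \<open>The new row and the new column contribute \<open>F v\<close> each, by symmetry;
    the new diagonal term is 0.\<close>
  have "(\<Sum>i<Suc n. \<Sum>j<Suc n. inner_powr p d s' i j)
      = (\<Sum>i<n. \<Sum>j<n. inner_powr p d s' i j) + 2 * F v"
    using F F' by (simp add: sum.distrib) (simp add: inner_powr_def)
  also have "\<dots> = (\<Sum>i<n. \<Sum>j<n. inner_powr p d s i j) + 2 * F v"
    using eq by simp
  also have "\<dots> \<le> B * (real n)\<^sup>2 + 2 * (B * n)"
    using sum v by simp
  \<comment> \<open>The increment \<open>2 * B * n\<close> fits below the difference
    \<open>B * (2 * n + 1)\<close> of consecutive squares.\<close>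
  also have "\<dots> \<le> B * (real (Suc n))\<^sup>2"
    using B by (simp add: power2_eq_square algebra_simps)
  finally have "(\<Sum>i<Suc n. \<Sum>j<Suc n. inner_powr p d s' i j) \<le> B * (real (Suc n))\<^sup>2" .
  moreover have "\<forall>i<Suc n. \<forall>k<d. s' i k \<in> {1, -1}"
    using s v(1) by (auto simp: s'_def V_def less_Suc_eq PiE_iff)
  ultimately show ?case unfolding B_def by blast
qed

text \<open>Markov's inequality: the average of \<open>R\<close> is at most \<open>B * n\<close>, so
  at most half of the indices exceed twice that value.\<close>

lemma card_small_terms:
  fixes R :: "nat \<Rightarrow> real"
  assumes "\<And>i. i < n \<Longrightarrow> 0 \<le> R i" "(\<Sum>i<n. R i) \<le> B * (real n)\<^sup>2" "B > 0"
  shows "real n / 2 \<le> card {i. i < n \<and> R i \<le> 2 * B * n}"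
proof (cases "n = 0")
  case False
  define bad where "bad = {i. i < n \<and> R i > 2 * B * n}"
  have "card bad * (2 * B * n) = (\<Sum>i\<in>bad. 2 * B * n)" by simp
  also have "\<dots> \<le> sum R bad" by (intro sum_mono) (auto simp: bad_def)
  also have "\<dots> \<le> (\<Sum>i<n. R i)" using assms(1) by (intro sum_mono2) (auto simp: bad_def)
  also have "\<dots> \<le> (n / 2) * (2 * B * n)" using assms(2) by (simp add: power2_eq_square mult_ac)
  finally have "real (card bad) \<le> n / 2" using False \<open>B > 0\<close> by simp
  moreover have "card ({i. i < n \<and> R i \<le> 2 * B * n} \<union> bad)
      = card {i. i < n \<and> R i \<le> 2 * B * n} + card bad"
    by (rule card_Un_disjoint) (auto simp: bad_def)
  moreover have "{i. i < n \<and> R i \<le> 2 * B * n} \<union> bad = {..<n}" by (auto simp: bad_def)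
  ultimately show ?thesis by simp
qed simp

section \<open>From success on zero and on unit vectors to the number of queries\<close>

lemma answer_cong:
  "(\<And>i. i \<in> queried b T \<Longrightarrow> b' $ i = b $ i) \<Longrightarrow> answer b' T = answer b T"
  by (induction T) auto

lemma answer_carrier: "well_formed n d T \<Longrightarrow> answer b T \<in> carrier_vec d"
  by (induction T) auto

lemma queried_subset: "well_formed n d T \<Longrightarrow> queried b T \<subseteq> {..<n}"
  by (induction T) auto

lemma lp_norm_nonneg: "0 \<le> lp_norm p v"
  by (simp add: lp_norm_def)

lemma abs_nth_le_lp_norm:
  assumes "p > 0" "i < dim_vec v"
  shows "\<bar>v $ i\<bar> \<le> lp_norm p v"
proof -
  have "\<bar>v $ i\<bar> = (\<bar>v $ i\<bar> powr p) powr (1 / p)" using assms by (simp add: powr_powr)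
  also have "\<dots> \<le> lp_norm p v"
    unfolding lp_norm_def using assms
    by (intro powr_mono2) (auto intro: member_le_sum[of i _ "\<lambda>i. \<bar>v $ i\<bar> powr p"])
  finally show ?thesis .
qed

lemma approx_solution_le:
  assumes "approx_solution p \<kappa> A b y" "x \<in> carrier_vec (dim_col A)" "\<kappa> \<ge> 0"
  shows "lp_norm p (A *\<^sub>v y - b) \<le> \<kappa> * lp_norm p (A *\<^sub>v x - b)"
proof -
  have "(INF x\<in>carrier_vec (dim_col A). lp_norm p (A *\<^sub>v x - b)) \<le> lp_norm p (A *\<^sub>v x - b)"
    using assms(2) by (intro cINF_lower bdd_belowI[of _ 0]) (auto simp: lp_norm_nonneg)
  then show ?thesis
    using assms unfolding approx_solution_def by (meson mult_left_mono order_trans)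
qed

text \<open>
  Success on \<open>0\<close> forces a residual of \<open>0\<close>, which is not good enough for the right-hand side
  \<open>unit_vec n i\<close>.
\<close>

lemma queried_if_approx_solutions:
  assumes A: "A \<in> carrier_mat n d" and T: "well_formed n d T" and "i < n" "p > 0" "\<kappa> \<ge> 0"
    and x: "x \<in> carrier_vec d" "\<kappa> * lp_norm p (A *\<^sub>v x - unit_vec n i) < 1"
    and s0: "approx_solution p \<kappa> A (0\<^sub>v n) (answer (0\<^sub>v n) T)"
    and si: "approx_solution p \<kappa> A (unit_vec n i) (answer (unit_vec n i) T)"
  shows "i \<in> queried (0\<^sub>v n) T"
proof (rule ccontr)
  assume i: "i \<notin> queried (0\<^sub>v n) T"
  define y where "y = answer (0\<^sub>v n) T"
  have y: "y \<in> carrier_vec d" unfolding y_def using T by (rule answer_carrier)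
  have "answer (unit_vec n i) T = y"
    unfolding y_def
  proof (rule answer_cong)
    fix j assume "j \<in> queried (0\<^sub>v n) T"
    then have "j < n" "j \<noteq> i" using queried_subset[OF T] i by auto
    then show "unit_vec n i $ j = (0\<^sub>v n :: real vec) $ j" using \<open>i < n\<close> by simp
  qed
  with si approx_solution_le[OF _ _ \<open>\<kappa> \<ge> 0\<close>, of p A "unit_vec n i" y x] A x
  have "lp_norm p (A *\<^sub>v y - unit_vec n i) < 1" by auto
  then have "\<bar>(A *\<^sub>v y - unit_vec n i) $ i\<bar> < 1"
    using abs_nth_le_lp_norm[OF \<open>p > 0\<close>, of i "A *\<^sub>v y - unit_vec n i"] A \<open>i < n\<close> by simp
  moreover have "(A *\<^sub>v y) $ i = 0"
  proof -
    \<comment> \<open>The point 0 fits the right-hand side 0 exactly, so a relative error bound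
      leaves no slack, whatever the size of \<open>\<kappa>\<close>.\<close>
    have "A *\<^sub>v 0\<^sub>v d - 0\<^sub>v n = 0\<^sub>v n" using A by (intro eq_vecI) auto
    then have "lp_norm p (A *\<^sub>v y - 0\<^sub>v n) \<le> \<kappa> * lp_norm p (0\<^sub>v n)"
      using approx_solution_le[OF s0 _ \<open>\<kappa> \<ge> 0\<close>, of "0\<^sub>v d"] A by (simp add: y_def)
    also have "lp_norm p (0\<^sub>v n) = 0" using \<open>p > 0\<close> by (simp add: lp_norm_def)
    finally show ?thesis
      using abs_nth_le_lp_norm[OF \<open>p > 0\<close>, of i "A *\<^sub>v y - 0\<^sub>v n"] A \<open>i < n\<close> by simp
  qed
  ultimately show False using A y \<open>i < n\<close> by simp
qed

lemma expected_queries_ge: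
  assumes alg: "solves_lp_regression p \<kappa> n d alg" and A: "A \<in> carrier_mat n d"
    and G: "G \<subseteq> {..<n}" and "p > 0" "\<kappa> \<ge> 0"
    and x: "\<And>i. i \<in> G \<Longrightarrow> \<exists>x\<in>carrier_vec d. \<kappa> * lp_norm p (A *\<^sub>v x - unit_vec n i) < 1"
  shows "ennreal (0.98 * card G) \<le> expected_queries (alg A) (0\<^sub>v n)"
proof -
  define M where "M = alg A"
  define S where "S b = {T \<in> space M. approx_solution p \<kappa> A b (answer b T)}" for b
  from alg A have ra: "randomized_algorithm n d M"
    and S: "\<And>b. b \<in> carrier_vec n \<Longrightarrow> measure M (S b) \<ge> 0.99"
    unfolding solves_lp_regression_def M_def S_def by auto
  interpret prob_space M using ra by (simp add: randomized_algorithm_def)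
  have wf: "well_formed n d T" if "T \<in> space M" for T
    using ra that by (simp add: randomized_algorithm_def)
  \<comment> \<open>A set outside the sigma-algebra would have measure 0, contradicting the bound
    0.99.\<close>
  have ev: "S b \<in> events" if "b \<in> carrier_vec n" for b
    using S[OF that] measure_notin_sets[of "S b" M] by fastforce
  define E where "E i = S (0\<^sub>v n) \<inter> S (unit_vec n i)" for i
  have E: "E i \<in> events" for i unfolding E_def by (intro sets.Int ev) auto
  \<comment> \<open>Inclusion-exclusion: 0.99 + 0.99 - 1, as the union has probability at most
    1.\<close>
  have pE: "0.98 \<le> prob (E i)" for i
  proof -
    have "prob (S (0\<^sub>v n) \<union> S (unit_vec n i))
        = prob (S (0\<^sub>v n)) + prob (S (unit_vec n i)) - prob (E i)"
      unfolding E_def by (rule measure_Un3) (auto intro!: ev simp: fmeasurable_eq_sets)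
    then show ?thesis
      using S[of "0\<^sub>v n"] S[of "unit_vec n i"] prob_le_1[of "S (0\<^sub>v n) \<union> S (unit_vec n i)"] by simp
  qed
  have fin: "finite G" using G finite_subset by blast
  have "ennreal (0.98 * card G) = (\<Sum>i\<in>G. ennreal 0.98)"
    by (subst sum_ennreal) (auto simp: mult.commute)
  also have "\<dots> \<le> (\<Sum>i\<in>G. emeasure M (E i))"
    unfolding emeasure_eq_measure by (intro sum_mono ennreal_leI pE)
  also have "\<dots> = (\<integral>\<^sup>+ T. (\<Sum>i\<in>G. indicator (E i) T) \<partial>M)"
    using E by (simp add: nn_integral_sum)
  also have "\<dots> \<le> (\<integral>\<^sup>+ T. of_nat (card (queried (0\<^sub>v n) T)) \<partial>M)"
  proof (rule nn_integral_mono)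
    fix T assume T: "T \<in> space M"
    have "(\<Sum>i\<in>G. indicator (E i) T :: ennreal) = of_nat (card {i\<in>G. T \<in> E i})"
      using fin by (simp add: indicator_def sum.If_cases Int_def conj_commute)
    also have "{i\<in>G. T \<in> E i} \<subseteq> queried (0\<^sub>v n) T"
    proof
      fix i assume i: "i \<in> {i\<in>G. T \<in> E i}"
      then obtain x where "x \<in> carrier_vec d" "\<kappa> * lp_norm p (A *\<^sub>v x - unit_vec n i) < 1"
        using x by blast
      then show "i \<in> queried (0\<^sub>v n) T"
        using i G \<open>p > 0\<close> \<open>\<kappa> \<ge> 0\<close>
        by (intro queried_if_approx_solutions[OF A wf[OF T]]) (auto simp: E_def S_def)
    qed
    then have "card {i\<in>G. T \<in> E i} \<le> card (queried (0\<^sub>v n) T)"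
      using queried_subset[OF wf[OF T]] finite_subset by (intro card_mono) blast+
    finally show "(\<Sum>i\<in>G. indicator (E i) T :: ennreal) \<le> of_nat (card (queried (0\<^sub>v n) T))"
      by simp
  qed
  finally show ?thesis by (simp add: expected_queries_def M_def)
qed

section \<open>The residual of \<open>a\<^sub>i / d\<close> and the choice of parameters\<close>

lemma lp_norm_sign_residual:
  assumes s: "\<forall>i<n. \<forall>k<d. s i k \<in> {1, -1}" and "i < n" "d \<ge> 1" "p > 0"
  defines "A \<equiv> mat n d (\<lambda>(j, k). s j k)" and "x \<equiv> vec d (\<lambda>k. s i k / d)"
  shows "lp_norm p (A *\<^sub>v x - unit_vec n i)
           = (\<Sum>j<n. inner_powr p d s i j) powr (1 / p) * real d powr (- 1 / 2)"
proof -
  have "\<bar>(A *\<^sub>v x - unit_vec n i) $ j\<bar> powr p = inner_powr p d s i j * real d powr (- p / 2)"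
    if "j < n" for j
  proof -
    have e: "(A *\<^sub>v x) $ j = (\<Sum>k<d. s i k * s j k) / d"
      using that by (simp add: A_def x_def scalar_prod_def atLeast0LessThan sum_divide_distrib mult.commute)
    show ?thesis
    proof (cases "j = i")
      \<comment> \<open>The squared length of a sign vector is \<open>d\<close>, so coordinate
        \<open>i\<close> of \<open>A *\<^sub>v x\<close> is exactly 1 and the residual vanishes
        there. This is why \<open>inner_powr\<close> is 0 on the diagonal.\<close>
      case True
      have "(\<Sum>k<d. s i k * s i k) = (\<Sum>k<d. 1)"
        using s \<open>i < n\<close> by (intro sum.cong) fastforce+
      with e True that \<open>d \<ge> 1\<close> \<open>p > 0\<close> show ?thesis by (simp add: inner_powr_def)
    next
      case False
      have "(\<Sum>k<d. s i k * s j k) / d = (\<Sum>k<d. s i k * s j k) / sqrt d * real d powr (- 1 / 2)"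
        using \<open>d \<ge> 1\<close> by (simp add: powr_minus powr_half_sqrt field_simps)
      moreover have "(A *\<^sub>v x - unit_vec n i) $ j = (A *\<^sub>v x) $ j"
        using that False \<open>i < n\<close> by (simp add: A_def)
      ultimately have "\<bar>(A *\<^sub>v x - unit_vec n i) $ j\<bar>
          = \<bar>(\<Sum>k<d. s i k * s j k) / sqrt d\<bar> * real d powr (- 1 / 2)"
        using e by (simp add: abs_mult)
      then have "\<bar>(A *\<^sub>v x - unit_vec n i) $ j\<bar> powr p
          = \<bar>(\<Sum>k<d. s i k * s j k) / sqrt d\<bar> powr p * real d powr (- p / 2)"
        by (simp only: powr_mult powr_powr) simp
      then show ?thesis using False by (simp add: inner_powr_def)
    qed
  qed
  then have "(\<Sum>j<n. \<bar>(A *\<^sub>v x - unit_vec n i) $ j\<bar> powr p)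
      = (\<Sum>j<n. inner_powr p d s i j) * real d powr (- p / 2)"
    by (simp add: sum_distrib_right)
  then show ?thesis
    using \<open>p > 0\<close> by (simp add: lp_norm_def A_def powr_mult powr_powr sum_nonneg inner_powr_nonneg)
qed

theorem theorem14p5:
  fixes p q :: real
  assumes "2 \<le> q" and "q < p"
  shows "\<exists>c>0. \<exists>K>0. \<forall>d::nat\<ge>1. \<exists>n::nat.
           \<forall>alg :: real mat \<Rightarrow> decision_tree measure.
             solves_lp_regression p (c * real d powr (1 / 2 * (1 - q / p))) n d alg
               \<longrightarrow> worst_case_queries n d alg \<ge> ennreal (K * real d powr (q / 2))"
proof -
  define B where "B = powr_exp_const p * (2 * exp 1)"
  have B: "B > 0" using powr_exp_const_pos by (simp add: B_def)
  \<comment> \<open>For good \<open>i\<close> the residual is at most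
    \<open>(4 * B) powr (1 / p)\<close> times a power of \<open>d\<close>, where
    \<open>4 * B\<close> is \<open>2 * B\<close> from Markov's inequality times 2 from rounding
    \<open>n\<close> up. The extra factor 2 in the denominator makes \<open>\<kappa>\<close> times
    the residual at most 1/2.\<close>
  define c where "c = 1 / (2 * (4 * B) powr (1 / p))"
  have c: "c > 0" using B by (simp add: c_def)
  have "\<exists>n. \<forall>alg. solves_lp_regression p (c * real d powr (1 / 2 * (1 - q / p))) n d alg
               \<longrightarrow> worst_case_queries n d alg \<ge> ennreal (0.49 * real d powr (q / 2))"
    if d: "d \<ge> 1" for d :: nat
  proof -
    define \<kappa> where "\<kappa> = c * real d powr (1 / 2 * (1 - q / p))"
    have \<kappa>: "\<kappa> \<ge> 0" using c by (simp add: \<kappa>_def)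
    \<comment> \<open>Rounding up gives enough rows for the query count; as the power is at least 1,
      it at most doubles the number.\<close>
    define n where "n = nat \<lceil>real d powr (q / 2)\<rceil>"
    have "real d powr (q / 2) \<ge> 1" using d assms by (simp add: ge_one_powr_ge_zero)
    then have n: "real d powr (q / 2) \<le> n" "n \<le> 2 * real d powr (q / 2)"
      unfolding n_def by linarith+
    obtain s where s: "\<forall>i<n. \<forall>k<d. s i k \<in> {1, -1}"
      and sum: "(\<Sum>i<n. \<Sum>j<n. inner_powr p d s i j) \<le> B * (real n)\<^sup>2"
      using exists_sign_vectors[OF d, of p n] assms unfolding B_def by auto
    define R where "R i = (\<Sum>j<n. inner_powr p d s i j)" for i
    define G where "G = {i. i < n \<and> R i \<le> 2 * B * n}"
    define A where "A = mat n d (\<lambda>(j, k). s j k)"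
    have A: "A \<in> carrier_mat n d" by (simp add: A_def)
    have G: "real n / 2 \<le> card G"
      unfolding G_def using sum B
      by (intro card_small_terms) (auto simp: R_def sum_nonneg inner_powr_nonneg)
    have x: "\<exists>x\<in>carrier_vec d. \<kappa> * lp_norm p (A *\<^sub>v x - unit_vec n i) < 1" if "i \<in> G" for i
    proof
      have "R i \<le> 2 * B * n" using that by (simp add: G_def)
      also have "\<dots> \<le> 2 * B * (2 * real d powr (q / 2))"
        using n(2) B by (intro mult_left_mono) auto
      finally have "R i powr (1 / p) \<le> (4 * B * real d powr (q / 2)) powr (1 / p)"
        using assms by (intro powr_mono2) (auto simp: R_def sum_nonneg inner_powr_nonneg)
      also have "\<dots> = (4 * B) powr (1 / p) * real d powr (q / (2 * p))"
        using B by (simp add: powr_mult powr_powr)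
      finally have "\<kappa> * (R i powr (1 / p) * real d powr (- 1 / 2))
          \<le> \<kappa> * ((4 * B) powr (1 / p) * real d powr (q / (2 * p)) * real d powr (- 1 / 2))"
        using \<kappa> by (intro mult_left_mono mult_right_mono) auto
      also have "\<dots> = c * (4 * B) powr (1 / p) *
          (real d powr (1 / 2 * (1 - q / p)) * real d powr (q / (2 * p)) * real d powr (- 1 / 2))"
        by (simp add: \<kappa>_def)
      also have "real d powr (1 / 2 * (1 - q / p)) * real d powr (q / (2 * p)) * real d powr (- 1 / 2)
          = real d powr (1 / 2 * (1 - q / p) + q / (2 * p) + - 1 / 2)"
        by (simp only: powr_add)
      \<comment> \<open>The allowed error cancels exactly against the growth of
        \<open>n powr (1 / p)\<close> and the factor \<open>1 / sqrt d\<close>.\<close>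
      also have "1 / 2 * (1 - q / p) + q / (2 * p) + - 1 / 2 = 0"
        using assms by (simp add: field_simps)
      also have "c * (4 * B) powr (1 / p) * real d powr 0 = 1 / 2"
        using B d by (simp add: c_def)
      finally show "\<kappa> * lp_norm p (A *\<^sub>v vec d (\<lambda>k. s i k / d) - unit_vec n i) < 1"
        using lp_norm_sign_residual[OF s _ d, of i p] that assms by (simp add: G_def R_def A_def)
    qed simp
    have "ennreal (0.49 * real d powr (q / 2)) \<le> worst_case_queries n d alg"
      if alg: "solves_lp_regression p \<kappa> n d alg" for alg
    proof -
      \<comment> \<open>The constant is 0.98 times the proportion 1/2 of good rows.\<close>
      have "ennreal (0.49 * real d powr (q / 2)) \<le> ennreal (0.98 * card G)"
        using n(1) G by (intro ennreal_leI) simp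
      also have "\<dots> \<le> expected_queries (alg A) (0\<^sub>v n)"
        using assms \<kappa> x by (intro expected_queries_ge[OF alg A]) (auto simp: G_def)
      also have "\<dots> \<le> worst_case_queries n d alg"
        unfolding worst_case_queries_def using A by (intro SUP_upper2[OF A] SUP_upper) auto
      finally show ?thesis .
    qed
    then show ?thesis unfolding \<kappa>_def by blast
  qed
  with c show ?thesis by (intro exI[of _ c] conjI exI[of _ "0.49 :: real"]) auto
qed

end
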